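(* Let $\mathcal{C}$ be a category which is preregular and finitary extensive. The union of the regular coverage and the extensive coverage on $\mathcal{C}$ generates the coherent topology on $\mathcal{C}$; that is, the Grothendieck topology generated by this union is equal to the coherent topology.
   Context: A morphism $f\colon Y\to X$ is an effective epimorphism if for every $e\colon Y\to W$ such that $e\circ g_1=e\circ g_2$ for all $g_1,g_2\colon Z\to Y$ with $f\circ g_1=f\circ g_2$, there is a unique $d\colon X\to W$ with $d\circ f=e$. A family of morphisms $(f_i\colon X_i\to B)_{i\in I}$ is effective epimorphic if for every object $W$ and every family $(e_i\colon X_i\to W)_{i\in I}$ such that $e_i\circ g_i=e_j\circ g_j$ whenever $i,j\in I$, $g_i\colon Z\to X_i$, $g_j\colon Z\to X_j$ satisfy $f_i\circ g_i=f_j\circ g_j$, there is a unique $d\colon B\to W$ with $d\circ f_i=e_i$ for all $i$. A category is preregular if for every effective epimorphism $g\colon Z\to Y$ and every morphism $f\colon X\to Y$ there exist an effective epimorphism $h\colon W\to X$ and a morphism $i\colon W\to Z$ with $g\circ i=f\circ h$. A category is finitary extensive if it has finite coproducts, it has pullbacks along coprojections of finite coproducts, and for every commutative diagram with top row $Z_1\to Z\leftarrow Z_2$, bottom row the coprojections $X\to X\coprod Y\leftarrow Y$, and vertical maps $Z_1\to X$, $Z\to X\coprod Y$, $Z_2\to Y$, both squares are pullbacks if and only if the top row is a coproduct diagram. A presieve on $X$ is a set of morphisms with target $X$ (families of morphisms are regarded as presieves). A coverage is the datum, for each object, of a set of presieves on it (the covering presieves) such that for every $f\colon X\to Y$ and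 covering presieve $S$ on $Y$ there is a covering presieve $T$ on $X$ such that for each $g\in T$, $f\circ g$ factors through some $h\in S$. The union of two coverages is a coverage. The Grothendieck topology generated by a coverage is the smallest Grothendieck topology in which the sieve generated by each covering presieve is a covering sieve. The regular coverage on a preregular category consists of the presieves consisting of a single effective epimorphism. The extensive coverage on a finitary extensive category consists of the finite families $(X_i\to X)_{i\in I}$ exhibiting $X$ as a coproduct of $(X_i)_{i\in I}$. The coherent topology is the one generated by the coverage consisting of all finite effective epimorphic families; this is a coverage exactly when $\mathcal{C}$ is precoherent, which holds when $\mathcal{C}$ is preregular and finitary extensive. *)

theory Defs
  imports Main
begin

section \<open>Categories, coproducts and pullbacks\<close>

record ('o, 'm) cat =
  Obj :: "'o set"
  Mor :: "'m set"
  Dom :: "'m \<Rightarrow> 'o"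
  Cod :: "'m \<Rightarrow> 'o"
  Ident :: "'o \<Rightarrow> 'm"
  Comp :: "'m \<Rightarrow> 'm \<Rightarrow> 'm"  (infixl "\<cdot>\<index>" 70)

definition hom :: "('o, 'm, 'x) cat_scheme \<Rightarrow> 'o \<Rightarrow> 'o \<Rightarrow> 'm set" where
  "hom C X Y = {f \<in> Mor C. Dom C f = X \<and> Cod C f = Y}"

locale category =
  fixes C :: "('o, 'm, 'x) cat_scheme" (structure)
  assumes dom_obj: "f \<in> Mor C \<Longrightarrow> Dom C f \<in> Obj C"
    and cod_obj: "f \<in> Mor C \<Longrightarrow> Cod C f \<in> Obj C"
    and ident_hom: "X \<in> Obj C \<Longrightarrow> Ident C X \<in> hom C X X"
    and comp_hom: "f \<in> hom C X Y \<Longrightarrow> g \<in> hom C Y Z \<Longrightarrow> g \<cdot> f \<in> hom C X Z"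
    and comp_ident: "f \<in> hom C X Y \<Longrightarrow> f \<cdot> Ident C X = f"
    and ident_comp: "f \<in> hom C X Y \<Longrightarrow> Ident C Y \<cdot> f = f"
    and comp_assoc: "f \<in> hom C X Y \<Longrightarrow> g \<in> hom C Y Z \<Longrightarrow> h \<in> hom C Z W \<Longrightarrow>
                       (h \<cdot> g) \<cdot> f = h \<cdot> (g \<cdot> f)"

text \<open>A family of morphisms into \<open>X\<close> is a function \<open>f\<close> on an index set \<open>I\<close>; the objects \<open>X\<^sub>i\<close>
  are the domains \<open>Dom C (f i)\<close>. Values of \<open>f\<close> outside \<open>I\<close> are irrelevant. Finite families are
  indexed by finite sets of natural numbers, so that repeated members are allowed.\<close>

definition family_into :: "('o, 'm, 'x) cat_scheme \<Rightarrow> 'i set \<Rightarrow> ('i \<Rightarrow> 'm) \<Rightarrow> 'o \<Rightarrow> bool" where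
  "family_into C I f X \<longleftrightarrow> X \<in> Obj C \<and> (\<forall>i\<in>I. f i \<in> Mor C \<and> Cod C (f i) = X)"

definition is_coproduct :: "('o, 'm, 'x) cat_scheme \<Rightarrow> 'i set \<Rightarrow> ('i \<Rightarrow> 'm) \<Rightarrow> 'o \<Rightarrow> bool" where
  "is_coproduct C I f X \<longleftrightarrow> family_into C I f X \<and>
     (\<forall>W\<in>Obj C. \<forall>e. (\<forall>i\<in>I. e i \<in> hom C (Dom C (f i)) W) \<longrightarrow>
        (\<exists>!d. d \<in> hom C X W \<and> (\<forall>i\<in>I. d \<cdot>\<^bsub>C\<^esub> f i = e i)))"

definition is_binary_coproduct :: "('o, 'm, 'x) cat_scheme \<Rightarrow> 'm \<Rightarrow> 'm \<Rightarrow> 'o \<Rightarrow> bool" where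
  "is_binary_coproduct C f g X \<longleftrightarrow> is_coproduct C {0, 1::nat} (\<lambda>i. if i = 0 then f else g) X"

text \<open>\<open>p : P \<rightarrow> X\<close> and \<open>q : P \<rightarrow> Y\<close> form a pullback of \<open>f : X \<rightarrow> S\<close> and \<open>g : Y \<rightarrow> S\<close>.\<close>

definition is_pullback :: "('o, 'm, 'x) cat_scheme \<Rightarrow> 'm \<Rightarrow> 'm \<Rightarrow> 'm \<Rightarrow> 'm \<Rightarrow> bool" where
  "is_pullback C p q f g \<longleftrightarrow>
     (\<exists>P X Y S. p \<in> hom C P X \<and> q \<in> hom C P Y \<and> f \<in> hom C X S \<and> g \<in> hom C Y S \<and>
        f \<cdot>\<^bsub>C\<^esub> p = g \<cdot>\<^bsub>C\<^esub> q \<and>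
        (\<forall>T\<in>Obj C. \<forall>a \<in> hom C T X. \<forall>b \<in> hom C T Y. f \<cdot>\<^bsub>C\<^esub> a = g \<cdot>\<^bsub>C\<^esub> b \<longrightarrow>
           (\<exists>!u. u \<in> hom C T P \<and> p \<cdot>\<^bsub>C\<^esub> u = a \<and> q \<cdot>\<^bsub>C\<^esub> u = b)))"


section \<open>Effective epimorphisms, preregular and finitary extensive categories\<close>

definition effective_epi :: "('o, 'm, 'x) cat_scheme \<Rightarrow> 'm \<Rightarrow> bool" where
  "effective_epi C f \<longleftrightarrow> f \<in> Mor C \<and>
     (\<forall>W\<in>Obj C. \<forall>e \<in> hom C (Dom C f) W.
        (\<forall>Z\<in>Obj C. \<forall>g\<^sub>1 \<in> hom C Z (Dom C f). \<forall>g\<^sub>2 \<in> hom C Z (Dom C f).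
           f \<cdot>\<^bsub>C\<^esub> g\<^sub>1 = f \<cdot>\<^bsub>C\<^esub> g\<^sub>2 \<longrightarrow> e \<cdot>\<^bsub>C\<^esub> g\<^sub>1 = e \<cdot>\<^bsub>C\<^esub> g\<^sub>2) \<longrightarrow>
        (\<exists>!d. d \<in> hom C (Cod C f) W \<and> d \<cdot>\<^bsub>C\<^esub> f = e))"

definition effective_epi_family ::
  "('o, 'm, 'x) cat_scheme \<Rightarrow> 'i set \<Rightarrow> ('i \<Rightarrow> 'm) \<Rightarrow> 'o \<Rightarrow> bool" where
  "effective_epi_family C I f B \<longleftrightarrow> family_into C I f B \<and>
     (\<forall>W\<in>Obj C. \<forall>e. (\<forall>i\<in>I. e i \<in> hom C (Dom C (f i)) W) \<longrightarrow>
        (\<forall>i\<in>I. \<forall>j\<in>I. \<forall>Z\<in>Obj C. \<forall>g\<^sub>i \<in> hom C Z (Dom C (f i)). \<forall>g\<^sub>j \<in> hom C Z (Dom C (f j)).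
           f i \<cdot>\<^bsub>C\<^esub> g\<^sub>i = f j \<cdot>\<^bsub>C\<^esub> g\<^sub>j \<longrightarrow> e i \<cdot>\<^bsub>C\<^esub> g\<^sub>i = e j \<cdot>\<^bsub>C\<^esub> g\<^sub>j) \<longrightarrow>
        (\<exists>!d. d \<in> hom C B W \<and> (\<forall>i\<in>I. d \<cdot>\<^bsub>C\<^esub> f i = e i)))"

definition preregular :: "('o, 'm, 'x) cat_scheme \<Rightarrow> bool" where
  "preregular C \<longleftrightarrow>
     (\<forall>g f. effective_epi C g \<longrightarrow> f \<in> Mor C \<longrightarrow> Cod C f = Cod C g \<longrightarrow>
        (\<exists>h i. effective_epi C h \<and> Cod C h = Dom C f \<and> i \<in> hom C (Dom C h) (Dom C g) \<and>
               g \<cdot>\<^bsub>C\<^esub> i = f \<cdot>\<^bsub>C\<^esub> h))"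

definition has_finite_coproducts :: "('o, 'm, 'x) cat_scheme \<Rightarrow> bool" where
  "has_finite_coproducts C \<longleftrightarrow>
     (\<forall>(I::nat set) X. finite I \<longrightarrow> (\<forall>i\<in>I. X i \<in> Obj C) \<longrightarrow>
        (\<exists>f S. is_coproduct C I f S \<and> (\<forall>i\<in>I. Dom C (f i) = X i)))"

definition has_pullbacks_along_coprojections :: "('o, 'm, 'x) cat_scheme \<Rightarrow> bool" where
  "has_pullbacks_along_coprojections C \<longleftrightarrow>
     (\<forall>(I::nat set) s S. finite I \<longrightarrow> is_coproduct C I s S \<longrightarrow>
        (\<forall>i\<in>I. \<forall>f \<in> Mor C. Cod C f = S \<longrightarrow> (\<exists>p q. is_pullback C p q (s i) f)))"

text \<open>The diagram in the last clause has top row \<open>z\<^sub>1 : Z\<^sub>1 \<rightarrow> Z \<leftarrow> Z\<^sub>2 : z\<^sub>2\<close>, bottom row the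
  coprojections \<open>\<iota>\<^sub>1 : X \<rightarrow> S \<leftarrow> Y : \<iota>\<^sub>2\<close> of a binary coproduct \<open>S\<close>, and vertical maps \<open>a\<close>, \<open>c\<close>, \<open>b\<close>.\<close>

definition finitary_extensive :: "('o, 'm, 'x) cat_scheme \<Rightarrow> bool" where
  "finitary_extensive C \<longleftrightarrow>
     has_finite_coproducts C \<and> has_pullbacks_along_coprojections C \<and>
     (\<forall>X Y S Z\<^sub>1 Z Z\<^sub>2 \<iota>\<^sub>1 \<iota>\<^sub>2 z\<^sub>1 z\<^sub>2 a b c.
        \<iota>\<^sub>1 \<in> hom C X S \<longrightarrow> \<iota>\<^sub>2 \<in> hom C Y S \<longrightarrow> is_binary_coproduct C \<iota>\<^sub>1 \<iota>\<^sub>2 S \<longrightarrow>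
        z\<^sub>1 \<in> hom C Z\<^sub>1 Z \<longrightarrow> z\<^sub>2 \<in> hom C Z\<^sub>2 Z \<longrightarrow>
        a \<in> hom C Z\<^sub>1 X \<longrightarrow> c \<in> hom C Z S \<longrightarrow> b \<in> hom C Z\<^sub>2 Y \<longrightarrow>
        \<iota>\<^sub>1 \<cdot>\<^bsub>C\<^esub> a = c \<cdot>\<^bsub>C\<^esub> z\<^sub>1 \<longrightarrow> \<iota>\<^sub>2 \<cdot>\<^bsub>C\<^esub> b = c \<cdot>\<^bsub>C\<^esub> z\<^sub>2 \<longrightarrow>
        (is_pullback C a z\<^sub>1 \<iota>\<^sub>1 c \<and> is_pullback C b z\<^sub>2 \<iota>\<^sub>2 c \<longleftrightarrow> is_binary_coproduct C z\<^sub>1 z\<^sub>2 Z))"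


section \<open>Coverages and Grothendieck topologies\<close>

text \<open>Coverages and Grothendieck topologies are functions on the type of objects; they are required
  to be empty outside \<open>Obj C\<close>, so that equality of functions is equality on \<open>Obj C\<close>.\<close>

definition presieve :: "('o, 'm, 'x) cat_scheme \<Rightarrow> 'o \<Rightarrow> 'm set \<Rightarrow> bool" where
  "presieve C X S \<longleftrightarrow> S \<subseteq> {f \<in> Mor C. Cod C f = X}"

definition coverage :: "('o, 'm, 'x) cat_scheme \<Rightarrow> ('o \<Rightarrow> 'm set set) \<Rightarrow> bool" where
  "coverage C K \<longleftrightarrow>
     (\<forall>X. X \<notin> Obj C \<longrightarrow> K X = {}) \<and>
     (\<forall>X\<in>Obj C. \<forall>S\<in>K X. presieve C X S) \<and>
     (\<forall>X\<in>Obj C. \<forall>Y\<in>Obj C. \<forall>f \<in> hom C X Y. \<forall>S\<in>K Y. \<exists>T\<in>K X.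
        \<forall>g\<in>T. \<exists>h\<in>S. \<exists>k \<in> hom C (Dom C g) (Dom C h). f \<cdot>\<^bsub>C\<^esub> g = h \<cdot>\<^bsub>C\<^esub> k)"

definition coverage_union ::
  "('o \<Rightarrow> 'm set set) \<Rightarrow> ('o \<Rightarrow> 'm set set) \<Rightarrow> 'o \<Rightarrow> 'm set set" where
  "coverage_union K L = (\<lambda>X. K X \<union> L X)"

definition sieve :: "('o, 'm, 'x) cat_scheme \<Rightarrow> 'o \<Rightarrow> 'm set \<Rightarrow> bool" where
  "sieve C X S \<longleftrightarrow> presieve C X S \<and>
     (\<forall>f\<in>S. \<forall>g \<in> Mor C. Cod C g = Dom C f \<longrightarrow> f \<cdot>\<^bsub>C\<^esub> g \<in> S)"

definition max_sieve :: "('o, 'm, 'x) cat_scheme \<Rightarrow> 'o \<Rightarrow> 'm set" where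
  "max_sieve C X = {f \<in> Mor C. Cod C f = X}"

definition sieve_generated :: "('o, 'm, 'x) cat_scheme \<Rightarrow> 'm set \<Rightarrow> 'm set" where
  "sieve_generated C S = {f \<cdot>\<^bsub>C\<^esub> g | f g. f \<in> S \<and> g \<in> Mor C \<and> Cod C g = Dom C f}"

definition pullback_sieve :: "('o, 'm, 'x) cat_scheme \<Rightarrow> 'm \<Rightarrow> 'm set \<Rightarrow> 'm set" where
  "pullback_sieve C f S = {g \<in> Mor C. Cod C g = Dom C f \<and> f \<cdot>\<^bsub>C\<^esub> g \<in> S}"

definition grothendieck_topology ::
  "('o, 'm, 'x) cat_scheme \<Rightarrow> ('o \<Rightarrow> 'm set set) \<Rightarrow> bool" where
  "grothendieck_topology C J \<longleftrightarrow>
     (\<forall>X. X \<notin> Obj C \<longrightarrow> J X = {}) \<and>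
     (\<forall>X\<in>Obj C. \<forall>S\<in>J X. sieve C X S) \<and>
     (\<forall>X\<in>Obj C. max_sieve C X \<in> J X) \<and>
     (\<forall>f\<in>Mor C. \<forall>S\<in>J (Cod C f). pullback_sieve C f S \<in> J (Dom C f)) \<and>
     (\<forall>X\<in>Obj C. \<forall>S\<in>J X. \<forall>R. sieve C X R \<longrightarrow>
        (\<forall>f\<in>S. pullback_sieve C f R \<in> J (Dom C f)) \<longrightarrow> R \<in> J X)"

definition topology_contains ::
  "('o, 'm, 'x) cat_scheme \<Rightarrow> ('o \<Rightarrow> 'm set set) \<Rightarrow> ('o \<Rightarrow> 'm set set) \<Rightarrow> bool" where
  "topology_contains C J K \<longleftrightarrow> (\<forall>X\<in>Obj C. \<forall>S\<in>K X. sieve_generated C S \<in> J X)"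

text \<open>This intersection is itself a Grothendieck topology with the required property, hence the
  smallest one: see \<open>generated_topology_smallest\<close> below.\<close>

definition generated_topology ::
  "('o, 'm, 'x) cat_scheme \<Rightarrow> ('o \<Rightarrow> 'm set set) \<Rightarrow> 'o \<Rightarrow> 'm set set" where
  "generated_topology C K =
     (\<lambda>X. \<Inter> {J X | J. grothendieck_topology C J \<and> topology_contains C J K})"

definition regular_coverage :: "('o, 'm, 'x) cat_scheme \<Rightarrow> 'o \<Rightarrow> 'm set set" where
  "regular_coverage C = (\<lambda>X. {{f} | f. effective_epi C f \<and> Cod C f = X})"

definition extensive_coverage :: "('o, 'm, 'x) cat_scheme \<Rightarrow> 'o \<Rightarrow> 'm set set" where
  "extensive_coverage C = (\<lambda>X. {f ` I | (I::nat set) f. finite I \<and> is_coproduct C I f X})"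

definition coherent_coverage :: "('o, 'm, 'x) cat_scheme \<Rightarrow> 'o \<Rightarrow> 'm set set" where
  "coherent_coverage C = (\<lambda>X. {f ` I | (I::nat set) f. finite I \<and> effective_epi_family C I f X})"

definition coherent_topology :: "('o, 'm, 'x) cat_scheme \<Rightarrow> 'o \<Rightarrow> 'm set set" where
  "coherent_topology C = generated_topology C (coherent_coverage C)"


section \<open>Well-definedness\<close>

context category
begin

lemma homD: "f \<in> hom C X Y \<Longrightarrow> f \<in> Mor C \<and> Dom C f = X \<and> Cod C f = Y \<and> X \<in> Obj C \<and> Y \<in> Obj C"
  using dom_obj cod_obj by (auto simp: hom_def)

lemma homI: "f \<in> Mor C \<Longrightarrow> f \<in> hom C (Dom C f) (Cod C f)"
  by (auto simp: hom_def)

lemma pullback_sieve_sieve: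
  assumes "f \<in> Mor C" "sieve C (Cod C f) S"
  shows "sieve C (Dom C f) (pullback_sieve C f S)"
proof -
  have "g \<cdot> h \<in> Mor C \<and> Cod C (g \<cdot> h) = Dom C f \<and> f \<cdot> (g \<cdot> h) \<in> S"
    if g: "g \<in> Mor C" "Cod C g = Dom C f" "f \<cdot> g \<in> S" and h: "h \<in> Mor C" "Cod C h = Dom C g"
    for g h
  proof -
    have f': "f \<in> hom C (Dom C f) (Cod C f)" and g': "g \<in> hom C (Dom C g) (Dom C f)"
      and h': "h \<in> hom C (Dom C h) (Dom C g)"
      using assms g h by (auto simp: hom_def)
    have "(f \<cdot> g) \<cdot> h \<in> S"
      using assms(2) g(3) h homD[OF comp_hom[OF g' f']] by (auto simp: sieve_def)
    then show ?thesis
      using comp_assoc[OF h' g' f'] homD[OF comp_hom[OF h' g']] by simp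
  qed
  then show ?thesis
    by (auto simp: sieve_def presieve_def pullback_sieve_def)
qed

lemma max_sieve_sieve: "sieve C X (max_sieve C X)"
proof -
  have "f \<cdot> g \<in> Mor C \<and> Cod C (f \<cdot> g) = Cod C f"
    if "f \<in> Mor C" "g \<in> Mor C" "Cod C g = Dom C f" for f g
    using homD[OF comp_hom[of g "Dom C g" "Dom C f" f "Cod C f"]] that by (auto simp: hom_def)
  then show ?thesis
    by (auto simp: sieve_def presieve_def max_sieve_def)
qed

lemma sieve_generated_sieve:
  assumes "presieve C X S"
  shows "sieve C X (sieve_generated C S)"
proof -
  have a: "f \<cdot> g \<in> hom C (Dom C g) X" if "f \<in> S" "g \<in> Mor C" "Cod C g = Dom C f" for f g
    using comp_hom[of g "Dom C g" "Dom C f" f X] that assms by (auto simp: hom_def presieve_def)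
  have b: "(f \<cdot> g) \<cdot> h \<in> sieve_generated C S"
    if "f \<in> S" "g \<in> Mor C" "Cod C g = Dom C f" "h \<in> Mor C" "Cod C h = Dom C g" for f g h
  proof -
    have f': "f \<in> hom C (Dom C f) X" and g': "g \<in> hom C (Dom C g) (Dom C f)"
      and h': "h \<in> hom C (Dom C h) (Dom C g)"
      using assms that by (auto simp: hom_def presieve_def)
    show ?thesis
      using comp_assoc[OF h' g' f'] homD[OF comp_hom[OF h' g']] that
      by (auto simp: sieve_generated_def)
  qed
  show ?thesis
    unfolding sieve_def
  proof (intro conjI ballI impI)
    show "presieve C X (sieve_generated C S)"
      using homD[OF a] by (auto simp: presieve_def sieve_generated_def)
    show "u \<cdot> h \<in> sieve_generated C S"
      if "u \<in> sieve_generated C S" "h \<in> Mor C" "Cod C h = Dom C u" for u h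
      using that b homD[OF a] by (auto simp: sieve_generated_def)
  qed
qed

lemma topologyD:
  assumes "grothendieck_topology C J"
  shows "X \<notin> Obj C \<Longrightarrow> J X = {}"
    and "X \<in> Obj C \<Longrightarrow> S \<in> J X \<Longrightarrow> sieve C X S"
    and "X \<in> Obj C \<Longrightarrow> max_sieve C X \<in> J X"
    and "f \<in> Mor C \<Longrightarrow> S \<in> J (Cod C f) \<Longrightarrow> pullback_sieve C f S \<in> J (Dom C f)"
    and "X \<in> Obj C \<Longrightarrow> S \<in> J X \<Longrightarrow> sieve C X R \<Longrightarrow>
           (\<And>f. f \<in> S \<Longrightarrow> pullback_sieve C f R \<in> J (Dom C f)) \<Longrightarrow> R \<in> J X"
proof -
  note J = assms[unfolded grothendieck_topology_def]
  show "X \<notin> Obj C \<Longrightarrow> J X = {}"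
    using J[THEN conjunct1] by blast
  show "X \<in> Obj C \<Longrightarrow> S \<in> J X \<Longrightarrow> sieve C X S"
    using J[THEN conjunct2, THEN conjunct1] by blast
  show "X \<in> Obj C \<Longrightarrow> max_sieve C X \<in> J X"
    using J[THEN conjunct2, THEN conjunct2, THEN conjunct1] by blast
  show "f \<in> Mor C \<Longrightarrow> S \<in> J (Cod C f) \<Longrightarrow> pullback_sieve C f S \<in> J (Dom C f)"
    using J[THEN conjunct2, THEN conjunct2, THEN conjunct2, THEN conjunct1] by blast
  show "X \<in> Obj C \<Longrightarrow> S \<in> J X \<Longrightarrow> sieve C X R \<Longrightarrow>
           (\<And>f. f \<in> S \<Longrightarrow> pullback_sieve C f R \<in> J (Dom C f)) \<Longrightarrow> R \<in> J X"
    using J[THEN conjunct2, THEN conjunct2, THEN conjunct2, THEN conjunct2] by blast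
qed

lemma top_topology: "grothendieck_topology C (\<lambda>X. if X \<in> Obj C then {S. sieve C X S} else {})"
  unfolding grothendieck_topology_def
  by (intro conjI ballI allI impI)
    (simp_all add: pullback_sieve_sieve max_sieve_sieve dom_obj cod_obj)

theorem generated_topology_smallest:
  assumes "\<And>X S. X \<in> Obj C \<Longrightarrow> S \<in> K X \<Longrightarrow> presieve C X S"
  shows "grothendieck_topology C (generated_topology C K)"
    and "topology_contains C (generated_topology C K) K"
    and "grothendieck_topology C J \<Longrightarrow> topology_contains C J K \<Longrightarrow> generated_topology C K X \<subseteq> J X"
proof -
  have mem: "S \<in> generated_topology C K X \<longleftrightarrow>
      (\<forall>J. grothendieck_topology C J \<longrightarrow> topology_contains C J K \<longrightarrow> S \<in> J X)" for S X
    by (auto simp: generated_topology_def)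
  have top: "topology_contains C (\<lambda>X. if X \<in> Obj C then {S. sieve C X S} else {}) K"
    using assms sieve_generated_sieve by (auto simp: topology_contains_def)
  have in_top: "S \<in> (if X \<in> Obj C then {S. sieve C X S} else {})"
    if "S \<in> generated_topology C K X" for S X
    using that top top_topology unfolding mem by blast
  show "grothendieck_topology C (generated_topology C K)"
    unfolding grothendieck_topology_def
  proof (intro conjI allI impI ballI)
    show "generated_topology C K X = {}" if "X \<notin> Obj C" for X
      using in_top that by fastforce
    show "sieve C X S" if "X \<in> Obj C" "S \<in> generated_topology C K X" for X S
      using in_top that by fastforce
    show "max_sieve C X \<in> generated_topology C K X" if "X \<in> Obj C" for X
      using that topologyD(3) by (simp add: mem)
    show "pullback_sieve C f S \<in> generated_topology C K (Dom C f)"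
      if "f \<in> Mor C" "S \<in> generated_topology C K (Cod C f)" for f S
      using that topologyD(4) by (simp add: mem)
    show "R \<in> generated_topology C K X"
      if "X \<in> Obj C" "S \<in> generated_topology C K X" "sieve C X R"
        "\<forall>f\<in>S. pullback_sieve C f R \<in> generated_topology C K (Dom C f)" for X S R
      unfolding mem
    proof (intro allI impI)
      fix J assume J: "grothendieck_topology C J" "topology_contains C J K"
      have "S \<in> J X" "\<forall>f\<in>S. pullback_sieve C f R \<in> J (Dom C f)"
        using that J unfolding mem by blast+
      then show "R \<in> J X"
        using topologyD(5)[OF J(1)] that(1,3) by simp
    qed
  qed
  show "topology_contains C (generated_topology C K) K"
    unfolding topology_contains_def mem by blast
  show "generated_topology C K X \<subseteq> J X"
    if "grothendieck_topology C J" "topology_contains C J K"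
    using that mem by blast
qed

lemma coverage_union_coverage:
  assumes K: "coverage C K" and L: "coverage C L"
  shows "coverage C (coverage_union K L)"
  unfolding coverage_def
proof (intro conjI ballI allI impI)
  show "coverage_union K L X = {}" if "X \<notin> Obj C" for X
    using assms that by (simp add: coverage_def coverage_union_def)
  show "presieve C X S" if "X \<in> Obj C" "S \<in> coverage_union K L X" for X S
    using assms that by (auto simp: coverage_def coverage_union_def)
  show "\<exists>T\<in>coverage_union K L X. \<forall>g\<in>T. \<exists>h\<in>S. \<exists>k\<in>hom C (Dom C g) (Dom C h). f \<cdot> g = h \<cdot> k"
    if "X \<in> Obj C" "Y \<in> Obj C" "f \<in> hom C X Y" "S \<in> coverage_union K L Y" for X Y f S
  proof -
    have "\<exists>T\<in>L' X. \<forall>g\<in>T. \<exists>h\<in>S. \<exists>k\<in>hom C (Dom C g) (Dom C h). f \<cdot> g = h \<cdot> k"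
      if "coverage C L'" "S \<in> L' Y" for L'
      using \<open>X \<in> Obj C\<close> \<open>Y \<in> Obj C\<close> \<open>f \<in> hom C X Y\<close> that by (simp add: coverage_def)
    from this[OF K] this[OF L] that(4) show ?thesis
      unfolding coverage_union_def by blast
  qed
qed

lemma effective_epi_obj: "effective_epi C f \<Longrightarrow> f \<in> Mor C \<and> Cod C f \<in> Obj C"
  using cod_obj by (auto simp: effective_epi_def)

lemma regular_coverage_coverage:
  assumes "preregular C"
  shows "coverage C (regular_coverage C)"
  unfolding coverage_def
proof (intro conjI ballI allI impI)
  show "regular_coverage C X = {}" if "X \<notin> Obj C" for X
    using that effective_epi_obj by (auto simp: regular_coverage_def)
  show "presieve C X S" if "S \<in> regular_coverage C X" for X S
    using that effective_epi_obj by (auto simp: regular_coverage_def presieve_def)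
  fix X Y f S assume f: "f \<in> hom C X Y" and "S \<in> regular_coverage C Y"
  then obtain g where g: "effective_epi C g" "Cod C g = Y" "S = {g}"
    by (auto simp: regular_coverage_def)
  moreover have "f \<in> Mor C" "Cod C f = Cod C g" "Dom C f = X"
    using g homD[OF f] by auto
  ultimately obtain h i where h: "effective_epi C h" "Cod C h = X"
      "i \<in> hom C (Dom C h) (Dom C g)" "f \<cdot> h = g \<cdot> i"
    using assms unfolding preregular_def by fastforce
  show "\<exists>T\<in>regular_coverage C X. \<forall>g\<in>T. \<exists>h\<in>S. \<exists>k\<in>hom C (Dom C g) (Dom C h). f \<cdot> g = h \<cdot> k"
    by (rule bexI[of _ "{h}"]) (use h g in \<open>auto simp: regular_coverage_def\<close>)
qed

lemma coproduct_hom: "is_coproduct C I x X \<Longrightarrow> i \<in> I \<Longrightarrow> x i \<in> hom C (Dom C (x i)) X"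
  by (auto simp: is_coproduct_def family_into_def hom_def)

lemma coproduct_ex:
  assumes "is_coproduct C I x X" "W \<in> Obj C" "\<And>i. i \<in> I \<Longrightarrow> e i \<in> hom C (Dom C (x i)) W"
  shows "\<exists>d\<in>hom C X W. \<forall>i\<in>I. d \<cdot> x i = e i"
proof -
  have "\<exists>!d. d \<in> hom C X W \<and> (\<forall>i\<in>I. d \<cdot> x i = e i)"
    using assms unfolding is_coproduct_def by blast
  then show ?thesis by blast
qed

lemma coproduct_eq:
  assumes "is_coproduct C I x X" "d \<in> hom C X W" "d' \<in> hom C X W"
    "\<And>i. i \<in> I \<Longrightarrow> d \<cdot> x i = d' \<cdot> x i"
  shows "d = d'"
proof -
  have W: "W \<in> Obj C" using homD[OF assms(2)] by simp
  have e: "\<forall>i\<in>I. d' \<cdot> x i \<in> hom C (Dom C (x i)) W"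
    using comp_hom[OF coproduct_hom[OF assms(1)] assms(3)] by simp
  have "\<forall>e. (\<forall>i\<in>I. e i \<in> hom C (Dom C (x i)) W) \<longrightarrow>
      (\<exists>!c. c \<in> hom C X W \<and> (\<forall>i\<in>I. c \<cdot> x i = e i))"
    using assms(1) W unfolding is_coproduct_def by simp
  from this[rule_format, of "\<lambda>i. d' \<cdot> x i"] e
  have "\<exists>!c. c \<in> hom C X W \<and> (\<forall>i\<in>I. c \<cdot> x i = d' \<cdot> x i)" by simp
  then obtain c where c: "\<And>b. b \<in> hom C X W \<and> (\<forall>i\<in>I. b \<cdot> x i = d' \<cdot> x i) \<Longrightarrow> b = c"
    by (elim ex1E) metis
  show ?thesis using c[of d] c[of d'] assms(2-4) by simp
qed

lemma coproductI:
  assumes "X \<in> Obj C" "\<And>i. i \<in> I \<Longrightarrow> x i \<in> hom C (Dom C (x i)) X"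
    "\<And>W e. W \<in> Obj C \<Longrightarrow> (\<And>i. i \<in> I \<Longrightarrow> e i \<in> hom C (Dom C (x i)) W) \<Longrightarrow>
       \<exists>d\<in>hom C X W. \<forall>i\<in>I. d \<cdot> x i = e i"
    "\<And>W d d'. d \<in> hom C X W \<Longrightarrow> d' \<in> hom C X W \<Longrightarrow>
       (\<And>i. i \<in> I \<Longrightarrow> d \<cdot> x i = d' \<cdot> x i) \<Longrightarrow> d = d'"
  shows "is_coproduct C I x X"
  unfolding is_coproduct_def
proof (intro conjI ballI allI impI)
  show "family_into C I x X"
    using assms(1,2) homD by (auto simp: family_into_def)
  fix W e assume "W \<in> Obj C" "\<forall>i\<in>I. e i \<in> hom C (Dom C (x i)) W"
  then obtain d where "d \<in> hom C X W" "\<forall>i\<in>I. d \<cdot> x i = e i"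
    using assms(3)[of W e] by blast
  then show "\<exists>!d. d \<in> hom C X W \<and> (\<forall>i\<in>I. d \<cdot> x i = e i)"
    using assms(4)[of _ W] by (intro ex1I[of _ d]) auto
qed

lemma binary_ex:
  assumes "is_binary_coproduct C u v X" "a \<in> hom C (Dom C u) W" "b \<in> hom C (Dom C v) W"
  obtains d where "d \<in> hom C X W" "d \<cdot> u = a" "d \<cdot> v = b"
proof -
  have "W \<in> Obj C" using assms(2) homD by blast
  moreover have "(if i = 0 then a else b) \<in> hom C (Dom C (if i = 0 then u else v)) W"
    if "i \<in> {0, 1::nat}" for i
    using assms(2,3) by simp
  ultimately have "\<exists>d\<in>hom C X W. \<forall>i\<in>{0, 1::nat}.
      d \<cdot> (if i = 0 then u else v) = (if i = 0 then a else b)"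
    by (rule coproduct_ex[OF assms(1)[unfolded is_binary_coproduct_def]])
  then show ?thesis using that by auto
qed

lemma binary_eq:
  assumes "is_binary_coproduct C u v X" "d \<in> hom C X W" "d' \<in> hom C X W"
    "d \<cdot> u = d' \<cdot> u" "d \<cdot> v = d' \<cdot> v"
  shows "d = d'"
  using coproduct_eq[OF assms(1)[unfolded is_binary_coproduct_def] assms(2,3)] assms(4,5) by simp

lemma binary_hom:
  assumes "is_binary_coproduct C u v X"
  shows "u \<in> hom C (Dom C u) X" "v \<in> hom C (Dom C v) X"
  using coproduct_hom[OF assms[unfolded is_binary_coproduct_def], of 0]
    coproduct_hom[OF assms[unfolded is_binary_coproduct_def], of 1] by simp_all

lemma binaryI:
  assumes "u \<in> hom C U X" "v \<in> hom C V X"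
    "\<And>W a b. a \<in> hom C U W \<Longrightarrow> b \<in> hom C V W \<Longrightarrow> \<exists>d\<in>hom C X W. d \<cdot> u = a \<and> d \<cdot> v = b"
    "\<And>W d d'. d \<in> hom C X W \<Longrightarrow> d' \<in> hom C X W \<Longrightarrow> d \<cdot> u = d' \<cdot> u \<Longrightarrow> d \<cdot> v = d' \<cdot> v \<Longrightarrow> d = d'"
  shows "is_binary_coproduct C u v X"
  unfolding is_binary_coproduct_def
proof (rule coproductI)
  note h = homD[OF assms(1)] homD[OF assms(2)]
  show "X \<in> Obj C" using h by blast
  show "(if i = 0 then u else v) \<in> hom C (Dom C (if i = 0 then u else v)) X" for i :: nat
    using h assms(1,2) by simp
  show "\<exists>d\<in>hom C X W. \<forall>i\<in>{0, 1}. d \<cdot> (if i = 0 then u else v) = e i"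
    if "\<And>i. i \<in> {0, 1} \<Longrightarrow> e i \<in> hom C (Dom C (if i = 0 then u else v)) W" for W and e :: "nat \<Rightarrow> _"
    using assms(3)[of "e 0" W "e 1"] that[of 0] that[of 1] h by simp
  show "d = d'" if "d \<in> hom C X W" "d' \<in> hom C X W"
    "\<And>i. i \<in> {0, 1::nat} \<Longrightarrow> d \<cdot> (if i = 0 then u else v) = d' \<cdot> (if i = 0 then u else v)" for W d d'
    using assms(4)[OF that(1,2)] that(3)[of 0] that(3)[of 1] by simp
qed

lemma pullbackE:
  assumes "is_pullback C p q f g" "f \<in> hom C X S" "g \<in> hom C Y S"
  obtains P where "p \<in> hom C P X" "q \<in> hom C P Y" "f \<cdot> p = g \<cdot> q"
  using assms unfolding is_pullback_def hom_def by auto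

lemma binary_coproduct_stable:
  assumes "finitary_extensive C" and b: "is_binary_coproduct C u v X" and f: "f \<in> hom C Y X"
  obtains p q k l where "is_binary_coproduct C p q Y" "k \<in> hom C (Dom C p) (Dom C u)"
    "l \<in> hom C (Dom C q) (Dom C v)" "f \<cdot> p = u \<cdot> k" "f \<cdot> q = v \<cdot> l"
proof -
  note ext = assms(1)[unfolded finitary_extensive_def]
  have pb: "\<exists>k p. is_pullback C k p (if i = 0 then u else v) f" if "i \<in> {0, 1::nat}" for i
    using ext[THEN conjunct2, THEN conjunct1, unfolded has_pullbacks_along_coprojections_def,
        rule_format, OF _ b[unfolded is_binary_coproduct_def] that, of f] homD[OF f] by simp
  obtain k p l q where kp: "is_pullback C k p u f" and lq: "is_pullback C l q v f"
    using pb[of 0] pb[of 1] by auto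
  obtain P where P: "k \<in> hom C P (Dom C u)" "p \<in> hom C P Y" "u \<cdot> k = f \<cdot> p"
    using pullbackE[OF kp binary_hom(1)[OF b] f] by blast
  obtain Q where Q: "l \<in> hom C Q (Dom C v)" "q \<in> hom C Q Y" "v \<cdot> l = f \<cdot> q"
    using pullbackE[OF lq binary_hom(2)[OF b] f] by blast
  have "is_binary_coproduct C p q Y"
    using ext[THEN conjunct2, THEN conjunct2, rule_format,
        OF binary_hom(1)[OF b] binary_hom(2)[OF b] b P(2) Q(2) P(1) f Q(1) P(3) Q(3)] kp lq
    by blast
  then show ?thesis
    using that[of p q k l] P Q homD[OF P(2)] homD[OF Q(2)] by simp
qed

lemma ident_pullback:
  assumes f: "f \<in> hom C Y X"
  shows "is_pullback C f (Ident C Y) (Ident C X) f"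
  unfolding is_pullback_def
proof (intro exI conjI ballI impI)
  note o = homD[OF f]
  show "f \<in> hom C Y X" "f \<in> hom C Y X" "Ident C Y \<in> hom C Y Y" "Ident C X \<in> hom C X X"
    using f o ident_hom by auto
  show "Ident C X \<cdot> f = f \<cdot> Ident C Y"
    using comp_ident[OF f] ident_comp[OF f] by simp
  fix T a b assume a: "a \<in> hom C T X" and b: "b \<in> hom C T Y" and "Ident C X \<cdot> a = f \<cdot> b"
  then have "f \<cdot> b = a" using ident_comp[OF a] by simp
  then show "\<exists>!u. u \<in> hom C T Y \<and> f \<cdot> u = a \<and> Ident C Y \<cdot> u = b"
    using b ident_comp[OF b] ident_comp[of _ T Y] by (intro ex1I[of _ b]) (simp, metis)
qed

lemma initial_strict:
  assumes ext: "finitary_extensive C" and i: "is_coproduct C {} x X" and f: "f \<in> hom C Y X"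
  shows "is_coproduct C {} y Y"
proof -
  note o = homD[OF f]
  note iX = ident_hom[of X] and iY = ident_hom[of Y]
  have "is_binary_coproduct C (Ident C X) (Ident C X) X"
  proof (rule binaryI)
    show "Ident C X \<in> hom C X X" "Ident C X \<in> hom C X X" using iX o by auto
    show "\<exists>d\<in>hom C X W. d \<cdot> Ident C X = a \<and> d \<cdot> Ident C X = b"
      if "a \<in> hom C X W" "b \<in> hom C X W" for W a b
      using coproduct_eq[OF i that] comp_ident[OF that(1)] that by auto
    show "d = d'" if "d \<in> hom C X W" "d' \<in> hom C X W" for W d d'
      using coproduct_eq[OF i that] by simp
  qed
  then have b: "is_binary_coproduct C (Ident C Y) (Ident C Y) Y"
    using ext[unfolded finitary_extensive_def, THEN conjunct2, THEN conjunct2, rule_format,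
        of "Ident C X" X X "Ident C X" X "Ident C Y" Y Y "Ident C Y" Y f f f]
      f ident_pullback[OF f] iX iY o comp_ident[OF f] ident_comp[OF f] by simp
  show ?thesis
  proof (rule coproductI)
    show "Y \<in> Obj C" using o by simp
    show "\<exists>d\<in>hom C Y W. \<forall>i\<in>{}. d \<cdot> y i = e i" if "W \<in> Obj C" for W e
    proof -
      obtain d where "d \<in> hom C X W" using coproduct_ex[OF i \<open>W \<in> Obj C\<close>] by blast
      then show ?thesis using comp_hom[OF f] by blast
    qed
    show "d = d'" if "d \<in> hom C Y W" "d' \<in> hom C Y W" for W d d'
    proof -
      have D: "Dom C (Ident C Y) = Y" using iY o homD by blast
      obtain c where "c \<in> hom C Y W" "c \<cdot> Ident C Y = d" "c \<cdot> Ident C Y = d'"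
        using binary_ex[OF b, unfolded D, OF \<open>d \<in> hom C Y W\<close> \<open>d' \<in> hom C Y W\<close>] by blast
      then show ?thesis by simp
    qed
  qed simp
qed

lemma coproduct_stable:
  fixes I :: "nat set"
  assumes ext: "finitary_extensive C"
  shows "finite I \<Longrightarrow> is_coproduct C I x X \<Longrightarrow> f \<in> hom C Y X \<Longrightarrow>
    \<exists>y k. is_coproduct C I y Y \<and>
      (\<forall>i\<in>I. k i \<in> hom C (Dom C (y i)) (Dom C (x i)) \<and> f \<cdot> y i = x i \<cdot> k i)"
proof (induction I arbitrary: x X f Y rule: finite_induct)
  case empty
  then show ?case using initial_strict[OF ext] by blast
next
  case (insert a I)
  note cX = insert.prems(1) and f = insert.prems(2)
  note xh = coproduct_hom[OF cX]
  have "\<exists>x' X'. is_coproduct C I x' X' \<and> (\<forall>i\<in>I. Dom C (x' i) = Dom C (x i))"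
    using ext[unfolded finitary_extensive_def, THEN conjunct1, unfolded has_finite_coproducts_def,
        rule_format, OF insert.hyps(1), of "\<lambda>i. Dom C (x i)"] xh homD by blast
  then obtain x' X' where c': "is_coproduct C I x' X'" and dx: "\<And>i. i \<in> I \<Longrightarrow> Dom C (x' i) = Dom C (x i)"
    by blast
  note xh' = coproduct_hom[OF c']
  have XO: "X \<in> Obj C" "X' \<in> Obj C"
    using cX c' by (auto simp: is_coproduct_def family_into_def)
  obtain u where u: "u \<in> hom C X' X" "\<And>i. i \<in> I \<Longrightarrow> u \<cdot> x' i = x i"
    using coproduct_ex[OF c' XO(1), of x] xh dx by auto
  have "is_binary_coproduct C (x a) u X"
  proof (rule binaryI[OF xh[of a, simplified] u(1)])
    fix W s t assume s: "s \<in> hom C (Dom C (x a)) W" and t: "t \<in> hom C X' W"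
    have ti: "t \<cdot> x' i \<in> hom C (Dom C (x i)) W" if "i \<in> I" for i
      using comp_hom[OF xh'[OF that] t] dx[OF that] by simp
    have "W \<in> Obj C" using homD[OF s] by blast
    moreover have "(if i = a then s else t \<cdot> x' i) \<in> hom C (Dom C (x i)) W" if "i \<in> insert a I" for i
      using that s ti by auto
    ultimately obtain d where d: "d \<in> hom C X W"
      "\<And>i. i \<in> insert a I \<Longrightarrow> d \<cdot> x i = (if i = a then s else t \<cdot> x' i)"
      using coproduct_ex[OF cX, of W "\<lambda>i. if i = a then s else t \<cdot> x' i"] by metis
    have "d \<cdot> u = t"
    proof (rule coproduct_eq[OF c' comp_hom[OF u(1) d(1)] t])
      fix i assume i: "i \<in> I"
      then have "i \<noteq> a" using insert.hyps(2) by auto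
      then show "(d \<cdot> u) \<cdot> x' i = t \<cdot> x' i"
        using comp_assoc[OF xh'[OF i] u(1) d(1)] u(2)[OF i] d(2)[of i] i by simp
    qed
    then show "\<exists>d\<in>hom C X W. d \<cdot> x a = s \<and> d \<cdot> u = t"
      using d(1) d(2)[of a] by (intro bexI[of _ d]) simp_all
  next
    fix W d d' assume d: "d \<in> hom C X W" "d' \<in> hom C X W" "d \<cdot> x a = d' \<cdot> x a" "d \<cdot> u = d' \<cdot> u"
    show "d = d'"
    proof (rule coproduct_eq[OF cX d(1,2)])
      fix i assume "i \<in> insert a I"
      then consider "i = a" | "i \<in> I" by blast
      then show "d \<cdot> x i = d' \<cdot> x i"
      proof cases
        case 2
        then show ?thesis
          using comp_assoc[OF xh'[OF 2] u(1) d(1)] comp_assoc[OF xh'[OF 2] u(1) d(2)] u(2) d(4)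
          by simp
      qed (use d in simp)
    qed
  qed
  then obtain p q k l where pq: "is_binary_coproduct C p q Y" "k \<in> hom C (Dom C p) (Dom C (x a))"
    "l \<in> hom C (Dom C q) (Dom C u)" "f \<cdot> p = x a \<cdot> k" "f \<cdot> q = u \<cdot> l"
    using binary_coproduct_stable[OF ext _ f] by metis
  note ph = binary_hom(1)[OF pq(1)] and qh = binary_hom(2)[OF pq(1)]
  have l: "l \<in> hom C (Dom C q) X'" using pq(3) homD[OF u(1)] by simp
  obtain y' k' where y': "is_coproduct C I y' (Dom C q)"
    "\<And>i. i \<in> I \<Longrightarrow> k' i \<in> hom C (Dom C (y' i)) (Dom C (x' i))" "\<And>i. i \<in> I \<Longrightarrow> l \<cdot> y' i = x' i \<cdot> k' i"
    using insert.IH[OF c' l] by blast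
  note yh' = coproduct_hom[OF y'(1)]
  define y where "y i = (if i = a then p else q \<cdot> y' i)" for i
  define k1 where "k1 i = (if i = a then k else k' i)" for i
  have qy: "q \<cdot> y' i \<in> hom C (Dom C (y' i)) Y" if "i \<in> I" for i
    using comp_hom[OF yh'[OF that] qh] .
  have ya: "y a = p" by (simp add: y_def)
  have yI: "y i = q \<cdot> y' i" "Dom C (y i) = Dom C (y' i)" "k1 i = k' i" if "i \<in> I" for i
    using that insert.hyps(2) homD[OF qy[OF that]] by (auto simp: y_def k1_def)
  have YO: "Y \<in> Obj C" using homD[OF f] by blast
  have "is_coproduct C (insert a I) y Y"
  proof (rule coproductI[OF YO])
    show "y i \<in> hom C (Dom C (y i)) Y" if "i \<in> insert a I" for i
      using that ya yI ph qy by auto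
  next
    fix W e assume W: "W \<in> Obj C" and e: "\<And>i. i \<in> insert a I \<Longrightarrow> e i \<in> hom C (Dom C (y i)) W"
    obtain t where t: "t \<in> hom C (Dom C q) W" "\<And>i. i \<in> I \<Longrightarrow> t \<cdot> y' i = e i"
      using coproduct_ex[OF y'(1) W, of e] e yI(2) by (metis insertCI)
    obtain d where d: "d \<in> hom C Y W" "d \<cdot> p = e a" "d \<cdot> q = t"
      using binary_ex[OF pq(1) _ t(1), of "e a"] e[of a] ya by auto
    have "d \<cdot> y i = e i" if "i \<in> I" for i
      using comp_assoc[OF yh'[OF that] qh d(1)] d(3) t(2)[OF that] yI(1)[OF that] by simp
    then show "\<exists>d\<in>hom C Y W. \<forall>i\<in>insert a I. d \<cdot> y i = e i"
      using d ya by auto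
  next
    fix W d d' assume d: "d \<in> hom C Y W" "d' \<in> hom C Y W"
      and eq: "\<And>i. i \<in> insert a I \<Longrightarrow> d \<cdot> y i = d' \<cdot> y i"
    have "d \<cdot> q = d' \<cdot> q"
    proof (rule coproduct_eq[OF y'(1) comp_hom[OF qh d(1)] comp_hom[OF qh d(2)]])
      fix i assume i: "i \<in> I"
      show "(d \<cdot> q) \<cdot> y' i = (d' \<cdot> q) \<cdot> y' i"
        using comp_assoc[OF yh'[OF i] qh d(1)] comp_assoc[OF yh'[OF i] qh d(2)] eq[of i] i yI(1)[OF i]
        by simp
    qed
    then show "d = d'"
      using binary_eq[OF pq(1) d] eq[of a] ya by simp
  qed
  moreover have "k1 i \<in> hom C (Dom C (y i)) (Dom C (x i)) \<and> f \<cdot> y i = x i \<cdot> k1 i" if "i \<in> insert a I" for i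
  proof (cases "i = a")
    case True
    then show ?thesis using pq ya by (simp add: k1_def)
  next
    case False
    then have i: "i \<in> I" using that by simp
    have "f \<cdot> (q \<cdot> y' i) = (u \<cdot> l) \<cdot> y' i"
      using comp_assoc[OF yh'[OF i] qh f] pq(5) by simp
    also have "\<dots> = u \<cdot> (x' i \<cdot> k' i)"
      using comp_assoc[OF yh'[OF i] l u(1)] y'(3)[OF i] by simp
    also have "\<dots> = x i \<cdot> k' i"
      using comp_assoc[OF y'(2)[OF i] xh'[OF i] u(1)] u(2)[OF i] by simp
    finally show ?thesis using yI[OF i] y'(2)[OF i] dx[OF i] by simp
  qed
  ultimately show ?case by blast
qed

theorem extensive_coverage_coverage:
  assumes "finitary_extensive C"
  shows "coverage C (extensive_coverage C)"
  unfolding coverage_def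
proof (intro conjI ballI allI impI)
  show "extensive_coverage C X = {}" if "X \<notin> Obj C" for X
    using that by (auto simp: extensive_coverage_def is_coproduct_def family_into_def)
  show "presieve C X S" if "S \<in> extensive_coverage C X" for X S
    using that by (auto simp: extensive_coverage_def is_coproduct_def family_into_def presieve_def)
  fix X Y f S assume f: "f \<in> hom C X Y" and "S \<in> extensive_coverage C Y"
  then obtain x and I :: "nat set" where S: "finite I" "is_coproduct C I x Y" "S = x ` I"
    by (auto simp: extensive_coverage_def)
  obtain y k where y: "is_coproduct C I y X"
    "\<And>i. i \<in> I \<Longrightarrow> k i \<in> hom C (Dom C (y i)) (Dom C (x i)) \<and> f \<cdot> y i = x i \<cdot> k i"
    using coproduct_stable[OF assms S(1,2) f] by blast
  show "\<exists>T\<in>extensive_coverage C X. \<forall>g\<in>T. \<exists>h\<in>S. \<exists>k\<in>hom C (Dom C g) (Dom C h). f \<cdot> g = h \<cdot> k"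
  proof (rule bexI[of _ "y ` I"])
    show "y ` I \<in> extensive_coverage C X"
      using S(1) y(1) by (auto simp: extensive_coverage_def)
    show "\<forall>g\<in>y ` I. \<exists>h\<in>S. \<exists>k\<in>hom C (Dom C g) (Dom C h). f \<cdot> g = h \<cdot> k"
      using y(2) S(3) by blast
  qed
qed

lemma effective_epiD:
  assumes "effective_epi C f" "f \<in> hom C Y X" "e \<in> hom C Y W"
    and compat: "\<And>Z g\<^sub>1 g\<^sub>2. g\<^sub>1 \<in> hom C Z Y \<Longrightarrow> g\<^sub>2 \<in> hom C Z Y \<Longrightarrow> f \<cdot> g\<^sub>1 = f \<cdot> g\<^sub>2 \<Longrightarrow> e \<cdot> g\<^sub>1 = e \<cdot> g\<^sub>2"
  shows "\<exists>!d. d \<in> hom C X W \<and> d \<cdot> f = e"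
proof -
  note o = homD[OF assms(2)] homD[OF assms(3)]
  have e: "e \<in> hom C (Dom C f) W" and W: "W \<in> Obj C" and X: "Cod C f = X"
    using o assms(3) by simp_all
  have c: "\<forall>Z\<in>Obj C. \<forall>g\<^sub>1 \<in> hom C Z (Dom C f). \<forall>g\<^sub>2 \<in> hom C Z (Dom C f).
           f \<cdot> g\<^sub>1 = f \<cdot> g\<^sub>2 \<longrightarrow> e \<cdot> g\<^sub>1 = e \<cdot> g\<^sub>2"
    using o by (intro ballI impI, intro compat) simp_all
  show ?thesis
    using assms(1)[unfolded effective_epi_def, THEN conjunct2, THEN bspec, OF W, THEN bspec, OF e,
      THEN mp, OF c] unfolding X .
qed

lemma effective_epi_familyD:
  assumes "effective_epi_family C I f B" "W \<in> Obj C" "\<And>i. i \<in> I \<Longrightarrow> e i \<in> hom C (Dom C (f i)) W"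
    and compat: "\<And>i j Z g\<^sub>1 g\<^sub>2. i \<in> I \<Longrightarrow> j \<in> I \<Longrightarrow> g\<^sub>1 \<in> hom C Z (Dom C (f i)) \<Longrightarrow>
      g\<^sub>2 \<in> hom C Z (Dom C (f j)) \<Longrightarrow> f i \<cdot> g\<^sub>1 = f j \<cdot> g\<^sub>2 \<Longrightarrow> e i \<cdot> g\<^sub>1 = e j \<cdot> g\<^sub>2"
  shows "\<exists>!d. d \<in> hom C B W \<and> (\<forall>i\<in>I. d \<cdot> f i = e i)"
proof -
  have e: "\<forall>i\<in>I. e i \<in> hom C (Dom C (f i)) W" using assms(3) by simp
  have c: "\<forall>i\<in>I. \<forall>j\<in>I. \<forall>Z\<in>Obj C. \<forall>g\<^sub>1 \<in> hom C Z (Dom C (f i)). \<forall>g\<^sub>2 \<in> hom C Z (Dom C (f j)).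
           f i \<cdot> g\<^sub>1 = f j \<cdot> g\<^sub>2 \<longrightarrow> e i \<cdot> g\<^sub>1 = e j \<cdot> g\<^sub>2"
    by (intro ballI impI, rule compat)
  show ?thesis
    using assms(1)[unfolded effective_epi_family_def, THEN conjunct2, THEN bspec, OF assms(2),
      THEN spec, THEN mp, OF e, THEN mp, OF c] .
qed

lemma effective_epi_family_hom:
  "effective_epi_family C I f B \<Longrightarrow> i \<in> I \<Longrightarrow> f i \<in> hom C (Dom C (f i)) B"
  by (simp add: effective_epi_family_def family_into_def hom_def)

lemma effective_epi_from_coproduct:
  fixes I :: "nat set"
  assumes ext: "finitary_extensive C" and fin: "finite I" and x: "effective_epi_family C I x B"
  shows "\<exists>s S t. is_coproduct C I s S \<and> (\<forall>i\<in>I. Dom C (s i) = Dom C (x i) \<and> t \<cdot> s i = x i) \<and>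
           t \<in> hom C S B \<and> effective_epi C t"
proof -
  note xh = effective_epi_family_hom[OF x]
  have BO: "B \<in> Obj C" using x by (simp add: effective_epi_family_def family_into_def)
  have "\<exists>s S. is_coproduct C I s S \<and> (\<forall>i\<in>I. Dom C (s i) = Dom C (x i))"
    using ext[unfolded finitary_extensive_def, THEN conjunct1, unfolded has_finite_coproducts_def,
        rule_format, OF fin, of "\<lambda>i. Dom C (x i)"] homD[OF xh] by simp
  then obtain s S where s: "is_coproduct C I s S" and ds: "\<And>i. i \<in> I \<Longrightarrow> Dom C (s i) = Dom C (x i)"
    by blast
  note sh = coproduct_hom[OF s]
  have "x i \<in> hom C (Dom C (s i)) B" if "i \<in> I" for i
    using ds[OF that] xh[OF that] by simp
  then obtain t where t: "t \<in> hom C S B" "\<And>i. i \<in> I \<Longrightarrow> t \<cdot> s i = x i"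
    using coproduct_ex[OF s BO, of x] by blast
  note ot = homD[OF t(1)]
  have "effective_epi C t"
    unfolding effective_epi_def
  proof (intro conjI ballI impI)
    show "t \<in> Mor C" using ot by simp
    fix W e assume W: "W \<in> Obj C" and "e \<in> hom C (Dom C t) W"
      and c: "\<forall>Z\<in>Obj C. \<forall>g\<^sub>1\<in>hom C Z (Dom C t). \<forall>g\<^sub>2\<in>hom C Z (Dom C t).
                t \<cdot> g\<^sub>1 = t \<cdot> g\<^sub>2 \<longrightarrow> e \<cdot> g\<^sub>1 = e \<cdot> g\<^sub>2"
    then have e: "e \<in> hom C S W" using ot by simp
    have es: "e \<cdot> s i \<in> hom C (Dom C (x i)) W" if "i \<in> I" for i
      using comp_hom[OF sh[OF that] e] ds[OF that] by simp
    have "\<exists>!d. d \<in> hom C B W \<and> (\<forall>i\<in>I. d \<cdot> x i = e \<cdot> s i)"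
    proof (rule effective_epi_familyD[OF x W es])
      fix i j Z g1 g2
      assume i: "i \<in> I" and j: "j \<in> I" and g1: "g1 \<in> hom C Z (Dom C (x i))"
        and g2: "g2 \<in> hom C Z (Dom C (x j))" and eq: "x i \<cdot> g1 = x j \<cdot> g2"
      have g: "g1 \<in> hom C Z (Dom C (s i))" "g2 \<in> hom C Z (Dom C (s j))"
        using g1 g2 ds i j by simp_all
      have "t \<cdot> (s i \<cdot> g1) = t \<cdot> (s j \<cdot> g2)"
        using comp_assoc[OF g(1) sh[OF i] t(1)] comp_assoc[OF g(2) sh[OF j] t(1)] t(2) i j eq by simp
      moreover have "s i \<cdot> g1 \<in> hom C Z (Dom C t)" "s j \<cdot> g2 \<in> hom C Z (Dom C t)"
        using comp_hom[OF g(1) sh[OF i]] comp_hom[OF g(2) sh[OF j]] ot by simp_all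
      ultimately have "e \<cdot> (s i \<cdot> g1) = e \<cdot> (s j \<cdot> g2)"
        using c[rule_format, of Z "s i \<cdot> g1" "s j \<cdot> g2"] homD[OF g1] by blast
      then show "(e \<cdot> s i) \<cdot> g1 = (e \<cdot> s j) \<cdot> g2"
        using comp_assoc[OF g(1) sh[OF i] e] comp_assoc[OF g(2) sh[OF j] e] by simp
    qed
    moreover have "d \<cdot> t = e \<longleftrightarrow> (\<forall>i\<in>I. d \<cdot> x i = e \<cdot> s i)" if d: "d \<in> hom C B W" for d
    proof -
      have "(d \<cdot> t) \<cdot> s i = d \<cdot> x i" if "i \<in> I" for i
        using comp_assoc[OF sh[OF that] t(1) d] t(2)[OF that] by simp
      then show ?thesis
        using coproduct_eq[OF s comp_hom[OF t(1) d] e] by fastforce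
    qed
    ultimately show "\<exists>!d. d \<in> hom C (Cod C t) W \<and> d \<cdot> t = e"
      using ot by (simp cong: conj_cong)
  qed
  then show ?thesis using s ds t by blast
qed

lemma effective_epi_family_from_coproduct:
  fixes I :: "nat set"
  assumes ext: "finitary_extensive C" and fin: "finite I" and w: "is_coproduct C I w W"
    and h: "effective_epi C h" "h \<in> hom C W Y"
  shows "effective_epi_family C I (\<lambda>i. h \<cdot> w i) Y"
proof -
  note wh = coproduct_hom[OF w]
  note oh = homD[OF h(2)]
  have hw: "h \<cdot> w i \<in> hom C (Dom C (w i)) Y" if "i \<in> I" for i
    using comp_hom[OF wh[OF that] h(2)] .
  have dw: "Dom C (h \<cdot> w i) = Dom C (w i)" if "i \<in> I" for i
    using homD[OF hw[OF that]] by simp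
  show ?thesis
    unfolding effective_epi_family_def
  proof (intro conjI ballI impI allI)
    show "family_into C I (\<lambda>i. h \<cdot> w i) Y"
      using homD[OF hw] oh by (simp add: family_into_def)
    fix V e assume V: "V \<in> Obj C" and e0: "\<forall>i\<in>I. e i \<in> hom C (Dom C (h \<cdot> w i)) V"
      and c: "\<forall>i\<in>I. \<forall>j\<in>I. \<forall>Z\<in>Obj C. \<forall>g\<^sub>i\<in>hom C Z (Dom C (h \<cdot> w i)).
                \<forall>g\<^sub>j\<in>hom C Z (Dom C (h \<cdot> w j)). (h \<cdot> w i) \<cdot> g\<^sub>i = (h \<cdot> w j) \<cdot> g\<^sub>j \<longrightarrow> e i \<cdot> g\<^sub>i = e j \<cdot> g\<^sub>j"
    have "e i \<in> hom C (Dom C (w i)) V" if "i \<in> I" for i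
      using e0 dw that by simp
    then obtain v where v: "v \<in> hom C W V" "\<And>i. i \<in> I \<Longrightarrow> v \<cdot> w i = e i"
      using coproduct_ex[OF w V, of e] by blast
    have "\<exists>!d. d \<in> hom C Y V \<and> d \<cdot> h = v"
    proof (rule effective_epiD[OF h v(1)])
      fix Z g1 g2 assume g1: "g1 \<in> hom C Z W" and g2: "g2 \<in> hom C Z W" and eq: "h \<cdot> g1 = h \<cdot> g2"
      obtain y k where y: "is_coproduct C I y Z"
        "\<And>i. i \<in> I \<Longrightarrow> k i \<in> hom C (Dom C (y i)) (Dom C (w i))" "\<And>i. i \<in> I \<Longrightarrow> g1 \<cdot> y i = w i \<cdot> k i"
        using coproduct_stable[OF ext fin w g1] by blast
      note yh = coproduct_hom[OF y(1)]
      show "v \<cdot> g1 = v \<cdot> g2"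
      proof (rule coproduct_eq[OF y(1) comp_hom[OF g1 v(1)] comp_hom[OF g2 v(1)]])
        fix i assume i: "i \<in> I"
        note g2y = comp_hom[OF yh[OF i] g2]
        obtain z l where z: "is_coproduct C I z (Dom C (y i))"
          "\<And>j. j \<in> I \<Longrightarrow> l j \<in> hom C (Dom C (z j)) (Dom C (w j))"
          "\<And>j. j \<in> I \<Longrightarrow> (g2 \<cdot> y i) \<cdot> z j = w j \<cdot> l j"
          using coproduct_stable[OF ext fin w g2y] by blast
        note zh = coproduct_hom[OF z(1)]
        have "v \<cdot> (g1 \<cdot> y i) = v \<cdot> (g2 \<cdot> y i)"
        proof (rule coproduct_eq[OF z(1) comp_hom[OF comp_hom[OF yh[OF i] g1] v(1)] comp_hom[OF g2y v(1)]])
          fix j assume j: "j \<in> I"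
          note g1y = comp_hom[OF yh[OF i] g1]
          note kz = comp_hom[OF zh[OF j] y(2)[OF i]]
          have 1: "(g1 \<cdot> y i) \<cdot> z j = w i \<cdot> (k i \<cdot> z j)"
            using comp_assoc[OF zh[OF j] y(2)[OF i] wh[OF i]] y(3)[OF i] by simp
          have "h \<cdot> ((g1 \<cdot> y i) \<cdot> z j) = h \<cdot> ((g2 \<cdot> y i) \<cdot> z j)"
            using comp_assoc[OF zh[OF j] g1y h(2)] comp_assoc[OF zh[OF j] g2y h(2)]
              comp_assoc[OF yh[OF i] g1 h(2)] comp_assoc[OF yh[OF i] g2 h(2)] eq by simp
          then have "(h \<cdot> w i) \<cdot> (k i \<cdot> z j) = (h \<cdot> w j) \<cdot> l j"
            using 1 z(3)[OF j] comp_assoc[OF kz wh[OF i] h(2)] comp_assoc[OF z(2)[OF j] wh[OF j] h(2)]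
            by simp
          then have "e i \<cdot> (k i \<cdot> z j) = e j \<cdot> l j"
            using c[rule_format, OF i j, of "Dom C (z j)" "k i \<cdot> z j" "l j"]
              kz z(2)[OF j] dw[OF i] dw[OF j] homD[OF kz] by simp
          then have "v \<cdot> (w i \<cdot> (k i \<cdot> z j)) = v \<cdot> (w j \<cdot> l j)"
            using comp_assoc[OF kz wh[OF i] v(1)] comp_assoc[OF z(2)[OF j] wh[OF j] v(1)] v(2) i j
            by simp
          then show "(v \<cdot> (g1 \<cdot> y i)) \<cdot> z j = (v \<cdot> (g2 \<cdot> y i)) \<cdot> z j"
            using comp_assoc[OF zh[OF j] g1y v(1)] comp_assoc[OF zh[OF j] g2y v(1)] 1 z(3)[OF j]
            by simp
        qed
        then show "(v \<cdot> g1) \<cdot> y i = (v \<cdot> g2) \<cdot> y i"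
          using comp_assoc[OF yh[OF i] g1 v(1)] comp_assoc[OF yh[OF i] g2 v(1)] by simp
      qed
    qed
    moreover have "d \<cdot> h = v \<longleftrightarrow> (\<forall>i\<in>I. d \<cdot> (h \<cdot> w i) = e i)" if d: "d \<in> hom C Y V" for d
    proof -
      have "(d \<cdot> h) \<cdot> w i = d \<cdot> (h \<cdot> w i)" if "i \<in> I" for i
        using comp_assoc[OF wh[OF that] h(2) d] .
      then show ?thesis
        using coproduct_eq[OF w comp_hom[OF h(2) d] v(1)] v(2) by fastforce
    qed
    ultimately show "\<exists>!d. d \<in> hom C Y V \<and> (\<forall>i\<in>I. d \<cdot> (h \<cdot> w i) = e i)"
      by (simp cong: conj_cong)
  qed
qed

theorem coherent_coverage_coverage:
  assumes reg: "preregular C" and ext: "finitary_extensive C"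
  shows "coverage C (coherent_coverage C)"
  unfolding coverage_def
proof (intro conjI ballI allI impI)
  show "coherent_coverage C X = {}" if "X \<notin> Obj C" for X
    using that by (auto simp: coherent_coverage_def effective_epi_family_def family_into_def)
  show "presieve C X S" if "S \<in> coherent_coverage C X" for X S
    using that
    by (auto simp: coherent_coverage_def effective_epi_family_def family_into_def presieve_def)
  fix X Y f S assume f: "f \<in> hom C X Y" and "S \<in> coherent_coverage C Y"
  then obtain x and I :: "nat set" where S: "finite I" "effective_epi_family C I x Y" "S = x ` I"
    by (auto simp: coherent_coverage_def)
  obtain s U t where s: "is_coproduct C I s U" "\<And>i. i \<in> I \<Longrightarrow> Dom C (s i) = Dom C (x i)"
    "\<And>i. i \<in> I \<Longrightarrow> t \<cdot> s i = x i" and t: "t \<in> hom C U Y" "effective_epi C t"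
    using effective_epi_from_coproduct[OF ext S(1,2)] by blast
  note sh = coproduct_hom[OF s(1)]
  have "Cod C f = Cod C t" "f \<in> Mor C" using homD[OF f] homD[OF t(1)] by simp_all
  then have "\<exists>h k. effective_epi C h \<and> Cod C h = Dom C f \<and> k \<in> hom C (Dom C h) (Dom C t) \<and> t \<cdot> k = f \<cdot> h"
    using reg[unfolded preregular_def, rule_format, OF t(2), of f] by simp
  then obtain h k where hk: "effective_epi C h" "Cod C h = X" "k \<in> hom C (Dom C h) U" "t \<cdot> k = f \<cdot> h"
    using homD[OF f] homD[OF t(1)] by auto
  have h: "h \<in> hom C (Dom C h) X"
    using homI[of h] effective_epi_obj[OF hk(1)] hk(2) by simp
  obtain w l where w: "is_coproduct C I w (Dom C h)"
    "\<And>i. i \<in> I \<Longrightarrow> l i \<in> hom C (Dom C (w i)) (Dom C (s i))" "\<And>i. i \<in> I \<Longrightarrow> k \<cdot> w i = s i \<cdot> l i"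
    using coproduct_stable[OF ext S(1) s(1) hk(3)] by blast
  note wh = coproduct_hom[OF w(1)]
  have l: "l i \<in> hom C (Dom C (h \<cdot> w i)) (Dom C (x i)) \<and> f \<cdot> (h \<cdot> w i) = x i \<cdot> l i" if i: "i \<in> I" for i
  proof -
    have "f \<cdot> (h \<cdot> w i) = (t \<cdot> k) \<cdot> w i"
      using comp_assoc[OF wh[OF i] h f] hk(4) by simp
    also have "\<dots> = t \<cdot> (s i \<cdot> l i)"
      using comp_assoc[OF wh[OF i] hk(3) t(1)] w(3)[OF i] by simp
    also have "\<dots> = x i \<cdot> l i"
      using comp_assoc[OF w(2)[OF i] sh[OF i] t(1)] s(3)[OF i] by simp
    finally show ?thesis
      using w(2)[OF i] s(2)[OF i] homD[OF comp_hom[OF wh[OF i] h]] by simp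
  qed
  show "\<exists>T\<in>coherent_coverage C X. \<forall>g\<in>T. \<exists>h\<in>S. \<exists>k\<in>hom C (Dom C g) (Dom C h). f \<cdot> g = h \<cdot> k"
  proof (rule bexI[of _ "(\<lambda>i. h \<cdot> w i) ` I"])
    show "(\<lambda>i. h \<cdot> w i) ` I \<in> coherent_coverage C X"
      using S(1) effective_epi_family_from_coproduct[OF ext S(1) w(1) hk(1) h]
      unfolding coherent_coverage_def by blast
    show "\<forall>g\<in>(\<lambda>i. h \<cdot> w i) ` I. \<exists>h\<in>S. \<exists>k\<in>hom C (Dom C g) (Dom C h). f \<cdot> g = h \<cdot> k"
      using l S(3) by blast
  qed
qed

end

end

theory Submission
  imports Defs
begin

text \<open>Both topologies are the smallest ones making certain presieves covering, so it suffices that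
  each of them makes the presieves generating the other covering.

  One direction holds because an effective epimorphism is an effective epimorphic family with one
  member and a coproduct cocone is an effective epimorphic family: a map out of a coproduct exists
  uniquely for every family of maps on the summands, in particular for the compatible ones.

  In the other direction, a finite effective epimorphic family \<open>x\<^sub>i : X\<^sub>i \<rightarrow> B\<close> factors through the
  coproduct \<open>S\<close> of its domains, as the coprojections \<open>s\<^sub>i : X\<^sub>i \<rightarrow> S\<close> followed by the induced map
  \<open>t : S \<rightarrow> B\<close>, and \<open>t\<close> is an effective epimorphism (\<open>effective_epi_from_coproduct\<close>). So the family
  is a regular covering followed by an extensive one, and coverings compose in any Grothendieck
  topology (\<open>covering_local\<close>, \<open>covering_composite\<close>).\<close>

context category
begin

lemma presieve_subset_sieve_generated:
  assumes "presieve C X S"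
  shows "S \<subseteq> sieve_generated C S"
proof
  fix f assume "f \<in> S"
  then have f: "f \<in> hom C (Dom C f) X" using assms by (auto simp: presieve_def hom_def)
  have "Ident C (Dom C f) \<in> hom C (Dom C f) (Dom C f)"
    using ident_hom homD[OF f] by blast
  then have "Ident C (Dom C f) \<in> Mor C" "Cod C (Ident C (Dom C f)) = Dom C f"
    by (simp_all add: hom_def)
  then show "f \<in> sieve_generated C S"
    using \<open>f \<in> S\<close> comp_ident[OF f, symmetric] unfolding sieve_generated_def by blast
qed

lemma pullback_sieve_comp:
  assumes f: "f \<in> hom C Y X" and g: "g \<in> hom C Z Y"
  shows "pullback_sieve C (f \<cdot> g) R = pullback_sieve C g (pullback_sieve C f R)"
proof -
  have "g \<cdot> h \<in> Mor C \<and> Cod C (g \<cdot> h) = Y \<and> (f \<cdot> g) \<cdot> h = f \<cdot> (g \<cdot> h)"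
    if "h \<in> Mor C" "Cod C h = Z" for h
  proof -
    have h: "h \<in> hom C (Dom C h) Z" using that by (simp add: hom_def)
    show ?thesis using homD[OF comp_hom[OF h g]] comp_assoc[OF h g f] by simp
  qed
  then show ?thesis
    using homD[OF f] homD[OF g] homD[OF comp_hom[OF g f]] by (auto simp: pullback_sieve_def)
qed

lemma pullback_sieve_member:
  assumes "sieve C X R" "f \<in> R"
  shows "pullback_sieve C f R = max_sieve C (Dom C f)"
  using assms by (auto simp: sieve_def pullback_sieve_def max_sieve_def)

text \<open>The transitivity axiom asks for a condition on every member of a covering sieve. It is enough
  to check it on a generating presieve, since a general member is \<open>f \<cdot> g\<close> with \<open>f\<close> in the presieve
  and pulling back along \<open>g\<close> preserves covering sieves.\<close>

lemma covering_local:
  assumes J: "grothendieck_topology C J" and X: "X \<in> Obj C"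
    and S: "presieve C X S" "sieve_generated C S \<in> J X" and R: "sieve C X R"
    and cov: "\<And>f. f \<in> S \<Longrightarrow> pullback_sieve C f R \<in> J (Dom C f)"
  shows "R \<in> J X"
proof (rule topologyD(5)[OF J X S(2) R])
  fix u assume "u \<in> sieve_generated C S"
  then obtain f g where u: "u = f \<cdot> g" and f: "f \<in> S" and g: "g \<in> Mor C" "Cod C g = Dom C f"
    by (auto simp: sieve_generated_def)
  have fh: "f \<in> hom C (Dom C f) X" and gh: "g \<in> hom C (Dom C g) (Dom C f)"
    using S(1) f g by (auto simp: presieve_def hom_def)
  have "pullback_sieve C g (pullback_sieve C f R) \<in> J (Dom C g)"
    using topologyD(4)[OF J g(1)] cov[OF f] g(2) by simp
  then show "pullback_sieve C u R \<in> J (Dom C u)"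
    using pullback_sieve_comp[OF fh gh] homD[OF comp_hom[OF gh fh]] u by simp
qed

text \<open>After pulling back the sieve generated by the composites along \<open>t\<close> and then along some \<open>s i\<close>,
  one has pulled back along \<open>t \<cdot> s i\<close>, a member of the sieve, and so obtains the maximal sieve.\<close>

lemma covering_composite:
  assumes J: "grothendieck_topology C J" and t: "t \<in> hom C Y X"
    and s: "\<And>i. i \<in> I \<Longrightarrow> s i \<in> hom C (Dom C (s i)) Y"
    and cov_t: "sieve_generated C {t} \<in> J X" and cov_s: "sieve_generated C (s ` I) \<in> J Y"
  shows "sieve_generated C ((\<lambda>i. t \<cdot> s i) ` I) \<in> J X"
proof -
  note ot = homD[OF t]
  have ts: "t \<cdot> s i \<in> hom C (Dom C (s i)) X" if "i \<in> I" for i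
    using comp_hom[OF s[OF that] t] .
  have pre: "presieve C X ((\<lambda>i. t \<cdot> s i) ` I)"
    using homD[OF ts] by (auto simp: presieve_def)
  let ?R = "sieve_generated C ((\<lambda>i. t \<cdot> s i) ` I)"
  have R: "sieve C X ?R" using sieve_generated_sieve[OF pre] .
  have "pullback_sieve C t ?R \<in> J Y"
  proof (rule covering_local[OF J _ _ cov_s])
    show "Y \<in> Obj C" using ot by simp
    show "presieve C Y (s ` I)" using homD[OF s] by (auto simp: presieve_def)
    show "sieve C Y (pullback_sieve C t ?R)"
      using pullback_sieve_sieve[of t ?R] R ot by simp
    fix f assume "f \<in> s ` I"
    then obtain i where i: "i \<in> I" "f = s i" by blast
    have "t \<cdot> s i \<in> ?R"
      using presieve_subset_sieve_generated[OF pre] i(1) by blast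
    then have "pullback_sieve C (t \<cdot> s i) ?R = max_sieve C (Dom C (s i))"
      using pullback_sieve_member[OF R] homD[OF ts[OF i(1)]] by simp
    then show "pullback_sieve C f (pullback_sieve C t ?R) \<in> J (Dom C f)"
      using pullback_sieve_comp[OF t s[OF i(1)]] topologyD(3)[OF J] homD[OF s[OF i(1)]] i(2)
      by simp
  qed
  then show ?thesis
    using covering_local[OF J _ _ cov_t R] ot by (simp add: presieve_def)
qed

lemma effective_epi_singleton_family:
  assumes "effective_epi C f"
  shows "effective_epi_family C {i} (\<lambda>_. f) (Cod C f)"
  unfolding effective_epi_family_def
proof (intro conjI ballI allI impI)
  show "family_into C {i} (\<lambda>_. f) (Cod C f)"
    using effective_epi_obj[OF assms] by (simp add: family_into_def)
  have f: "f \<in> hom C (Dom C f) (Cod C f)"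
    using homI effective_epi_obj[OF assms] by blast
  fix W e
  assume e: "\<forall>j\<in>{i}. e j \<in> hom C (Dom C f) W"
    and compat: "\<forall>j\<in>{i}. \<forall>k\<in>{i}. \<forall>Z\<in>Obj C. \<forall>g\<^sub>j\<in>hom C Z (Dom C f). \<forall>g\<^sub>k\<in>hom C Z (Dom C f).
      f \<cdot> g\<^sub>j = f \<cdot> g\<^sub>k \<longrightarrow> e j \<cdot> g\<^sub>j = e k \<cdot> g\<^sub>k"
  have "e i \<in> hom C (Dom C f) W" using e by blast
  then have "\<exists>!d. d \<in> hom C (Cod C f) W \<and> d \<cdot> f = e i"
  proof (rule effective_epiD[OF assms f])
    fix Z g1 g2 assume g: "g1 \<in> hom C Z (Dom C f)" "g2 \<in> hom C Z (Dom C f)" "f \<cdot> g1 = f \<cdot> g2"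
    have "Z \<in> Obj C" using homD[OF g(1)] by blast
    then show "e i \<cdot> g1 = e i \<cdot> g2"
      using compat[THEN bspec, THEN bspec, THEN bspec, THEN bspec, THEN bspec, THEN mp] g by blast
  qed
  then show "\<exists>!d. d \<in> hom C (Cod C f) W \<and> (\<forall>j\<in>{i}. d \<cdot> f = e j)" by simp
qed

lemma coproduct_effective_epi_family:
  assumes "is_coproduct C I x X"
  shows "effective_epi_family C I x X"
  unfolding effective_epi_family_def
  using assms[unfolded is_coproduct_def] by (intro conjI ballI allI impI) blast+

lemma regular_extensive_subset_coherent:
  "coverage_union (regular_coverage C) (extensive_coverage C) X \<subseteq> coherent_coverage C X"
proof
  fix S assume "S \<in> coverage_union (regular_coverage C) (extensive_coverage C) X"
  then consider f where "S = {f}" "effective_epi C f" "Cod C f = X"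
    | I :: "nat set" and x where "S = x ` I" "finite I" "is_coproduct C I x X"
    by (auto simp: coverage_union_def regular_coverage_def extensive_coverage_def)
  then show "S \<in> coherent_coverage C X"
  proof cases
    case 1
    then have "effective_epi_family C {0::nat} (\<lambda>_. f) X" "S = (\<lambda>_. f) ` {0::nat}" "finite {0::nat}"
      using effective_epi_singleton_family by auto
    then show ?thesis unfolding coherent_coverage_def by blast
  next
    case 2
    then show ?thesis
      using coproduct_effective_epi_family unfolding coherent_coverage_def by blast
  qed
qed

lemma topology_contains_coherent:
  assumes ext: "finitary_extensive C" and J: "grothendieck_topology C J"
    and contains: "topology_contains C J (coverage_union (regular_coverage C) (extensive_coverage C))"
  shows "topology_contains C J (coherent_coverage C)"
  unfolding topology_contains_def
proof (intro ballI)
  fix B S assume "B \<in> Obj C" and "S \<in> coherent_coverage C B"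
  then obtain x and I :: "nat set" where S: "finite I" "effective_epi_family C I x B" "S = x ` I"
    by (auto simp: coherent_coverage_def)
  obtain s U t where s: "is_coproduct C I s U" "\<And>i. i \<in> I \<Longrightarrow> t \<cdot> s i = x i"
    and t: "t \<in> hom C U B" "effective_epi C t"
    using effective_epi_from_coproduct[OF ext S(1,2)] by blast
  note ot = homD[OF t(1)]
  have cov: "sieve_generated C T \<in> J X"
    if "X \<in> Obj C" "T \<in> regular_coverage C X \<or> T \<in> extensive_coverage C X" for X T
    using contains that by (simp add: topology_contains_def coverage_union_def)
  have cov_t: "sieve_generated C {t} \<in> J B"
    using cov[of B "{t}"] t(2) ot by (simp add: regular_coverage_def)
  have "s ` I \<in> extensive_coverage C U"
    using S(1) s(1) unfolding extensive_coverage_def by blast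
  then have cov_s: "sieve_generated C (s ` I) \<in> J U"
    using cov ot by blast
  have "sieve_generated C ((\<lambda>i. t \<cdot> s i) ` I) \<in> J B"
    by (rule covering_composite[OF J t(1) _ cov_t cov_s]) (rule coproduct_hom[OF s(1)])
  moreover have "(\<lambda>i. t \<cdot> s i) ` I = S"
    using s(2) S(3) by auto
  ultimately show "sieve_generated C S \<in> J B" by simp
qed

end

theorem proposition5p9:
  fixes C :: "('o, 'm) cat"
  assumes "category C"
    and "preregular C"
    and "finitary_extensive C"
  shows "generated_topology C (coverage_union (regular_coverage C) (extensive_coverage C))
           = coherent_topology C"
proof -
  interpret category C by fact
  let ?K = "coverage_union (regular_coverage C) (extensive_coverage C)"
  let ?L = "coherent_coverage C"
  have L: "presieve C X S" if "X \<in> Obj C" "S \<in> ?L X" for X S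
    using coherent_coverage_coverage[OF assms(2,3)] that by (simp add: coverage_def)
  have K: "presieve C X S" if "X \<in> Obj C" "S \<in> ?K X" for X S
    using L that regular_extensive_subset_coherent by blast
  note genK = generated_topology_smallest[of ?K, OF K]
  note genL = generated_topology_smallest[of ?L, OF L]
  have "topology_contains C (generated_topology C ?L) ?K"
    using genL(2) regular_extensive_subset_coherent unfolding topology_contains_def by blast
  then have "generated_topology C ?K X \<subseteq> generated_topology C ?L X" for X
    using genK(3) genL(1) by blast
  moreover have "generated_topology C ?L X \<subseteq> generated_topology C ?K X" for X
    using genL(3) genK(1) topology_contains_coherent[OF assms(3) genK(1,2)] by blast
  ultimately show ?thesis
    unfolding coherent_topology_def by (intro ext subset_antisym)
qed

end
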